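(* Let $A\in\mathbb{R}^{n\times n}$ and $B\in\mathbb{R}^{n\times m}$ with $(A,B)$ controllable. Let $E(\alpha)$ and $F(\alpha)$ be real polynomial matrices in the scalar indeterminate $\alpha\in\mathbb{R}$, of sizes $n\times n$ and $n\times m$ respectively, with $E(0)=0$ and $F(0)=0$. Then there exists $\bar\alpha>0$ such that $(A+E(\alpha),B+F(\alpha))$ is controllable for all $\alpha\in\mathbb{R}$ with $|\alpha|\ge\bar\alpha$.
   Context: A pair $(A,B)$ is controllable if $\operatorname{rank}[B\ AB\ \cdots\ A^{n-1}B]=n$. *)

theory Defs
  imports "HOL-Analysis.Analysis" "HOL-Computational_Algebra.Polynomial"
begin

text \<open>Matrix power A^k for square matrices.\<close>
primrec mpow :: "real^'n^'n \<Rightarrow> nat \<Rightarrow> real^'n^'n" where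
  "mpow A 0 = mat 1"
| "mpow A (Suc k) = A ** mpow A k"

text \<open>A fixed enumeration of the finite index type 'n by 0,...,CARD('n)-1.
  It is used to order the blocks of the controllability matrix; the rank does
  not depend on the particular enumeration.\<close>
definition blk_idx :: "'n::finite \<Rightarrow> nat" where
  "blk_idx = (SOME f. bij_betw f (UNIV :: 'n set) {..<CARD('n)})"

text \<open>Controllability matrix [B, AB, ..., A^(n-1) B]; column (j,k) is column j
  of the block A^(blk_idx k) B.\<close>
definition ctrb_matrix :: "real^'n^'n \<Rightarrow> real^'m^'n \<Rightarrow> real^('m \<times> 'n)^'n" where
  "ctrb_matrix A B = (\<chi> i. \<chi> c. (mpow A (blk_idx (snd c)) ** B) $ i $ fst c)"

definition controllable :: "real^'n^'n \<Rightarrow> real^'m^'n \<Rightarrow> bool" where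
  "controllable A B \<longleftrightarrow> rank (ctrb_matrix A B) = CARD('n)"

text \<open>Entrywise evaluation of a polynomial matrix at a real number.\<close>
definition peval :: "real poly^'m^'n \<Rightarrow> real \<Rightarrow> real^'m^'n" where
  "peval E a = (\<chi> i j. poly (E $ i $ j) a)"

end

theory Submission
  imports Defs
begin

text \<open>Controllability of \<open>(P(a), Q(a))\<close> for polynomial matrices \<open>P, Q\<close> is the
  nonvanishing of the Gram determinant \<open>det (C(a) C(a)\<^sup>T)\<close> of the controllability
  matrix \<open>C(a)\<close>, which is a polynomial in \<open>a\<close>. For \<open>P = A + E\<close>, \<open>Q = B + F\<close> this
  polynomial is nonzero at \<open>a = 0\<close>, so it has only finitely many roots, and all of
  them lie in a bounded interval.\<close>

text \<open>The matrix power \<^const>\<open>mpow\<close>, generalised from real entries to any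
  semiring so that it applies to polynomial matrices.\<close>
primrec matrix_power :: "'a::semiring_1^'n^'n \<Rightarrow> nat \<Rightarrow> 'a^'n^'n" where
  "matrix_power A 0 = mat 1"
| "matrix_power A (Suc k) = A ** matrix_power A k"

definition const_poly_matrix :: "'a::zero^'m^'n \<Rightarrow> 'a poly^'m^'n" where
  "const_poly_matrix A = (\<chi> i j. [:A $ i $ j:])"

definition ctrb_poly_matrix :: "real poly^'n^'n \<Rightarrow> real poly^'m^'n \<Rightarrow> real poly^('m \<times> 'n)^'n" where
  "ctrb_poly_matrix P Q = (\<chi> i c. (matrix_power P (blk_idx (snd c)) ** Q) $ i $ fst c)"

lemma peval_add: "peval (X + Y) a = peval X a + peval Y a"
  by (simp add: peval_def vec_eq_iff)

lemma peval_matrix_mult: "peval (X ** Y) a = peval X a ** peval Y a"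
  by (simp add: peval_def vec_eq_iff matrix_matrix_mult_def poly_sum)

lemma peval_transpose: "peval (transpose X) a = transpose (peval X a)"
  by (simp add: peval_def vec_eq_iff transpose_def)

lemma peval_mat_1: "peval (mat 1) a = mat 1"
  by (simp add: peval_def vec_eq_iff mat_def)

lemma peval_matrix_power: "peval (matrix_power X k) a = mpow (peval X a) k"
  by (induction k) (simp_all add: peval_mat_1 peval_matrix_mult)

lemma peval_const_poly_matrix: "peval (const_poly_matrix A) a = A"
  by (simp add: peval_def const_poly_matrix_def vec_eq_iff)

lemma det_peval: "det (peval X a) = poly (det X) a"
  unfolding det_def by (simp add: peval_def poly_sum poly_prod)

lemma peval_ctrb_poly_matrix:
  "peval (ctrb_poly_matrix P Q) a = ctrb_matrix (peval P a) (peval Q a)"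
  unfolding ctrb_matrix_def peval_matrix_power[symmetric] peval_matrix_mult[symmetric]
  by (simp add: ctrb_poly_matrix_def peval_def vec_eq_iff)

lemma injective_matrix_mult_transpose:
  fixes M :: "real^'k^'n"
  assumes "inj ((*v) (transpose M))"
  shows "inj ((*v) (M ** transpose M))"
proof (rule linear_injective_0[THEN iffD2])
  show "linear ((*v) (M ** transpose M))" by simp
  show "\<forall>x. (M ** transpose M) *v x = 0 \<longrightarrow> x = 0"
  proof (intro allI impI)
    fix x assume "(M ** transpose M) *v x = 0"
    then have "x \<bullet> (M *v (transpose M *v x)) = 0"
      by (metis matrix_vector_mul_assoc inner_zero_right)
    then have "(transpose M *v x) \<bullet> (transpose M *v x) = 0"
      by (metis dot_lmul_matrix inner_commute vector_transpose_matrix)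
    then have "transpose M *v x = 0" by simp
    then show "x = 0"
      using assms by (metis injD matrix_vector_mult_0_right)
  qed
qed

lemma full_rank_iff_det_gram:
  fixes M :: "real^'k^'n"
  shows "rank M = CARD('n) \<longleftrightarrow> det (M ** transpose M) \<noteq> 0"
proof
  assume "rank M = CARD('n)"
  then have "inj ((*v) (transpose M))"
    using rank_transpose[of M] full_rank_injective[of "transpose M"] by simp
  then have "rank (M ** transpose M) = CARD('n)"
    using injective_matrix_mult_transpose full_rank_injective by blast
  then show "det (M ** transpose M) \<noteq> 0"
    by (simp add: det_eq_0_rank)
next
  assume "det (M ** transpose M) \<noteq> 0"
  then have "rank (M ** transpose M) = CARD('n)"
    using det_eq_0_rank rank_bound[of "M ** transpose M"] by fastforce
  then show "rank M = CARD('n)"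
    using rank_mul_le_left[of M "transpose M"] rank_bound[of M] by linarith
qed

lemma controllable_peval_iff:
  fixes P :: "real poly^'n^'n" and Q :: "real poly^'m^'n"
  defines "C \<equiv> ctrb_poly_matrix P Q"
  shows "controllable (peval P a) (peval Q a) \<longleftrightarrow> poly (det (C ** transpose C)) a \<noteq> 0"
  unfolding controllable_def full_rank_iff_det_gram C_def peval_ctrb_poly_matrix[symmetric]
    peval_transpose[symmetric] peval_matrix_mult[symmetric] det_peval ..

lemma finite_uncontrollable_parameters:
  fixes P :: "real poly^'n^'n" and Q :: "real poly^'m^'n"
  assumes "controllable (peval P a\<^sub>0) (peval Q a\<^sub>0)"
  shows "finite {a. \<not> controllable (peval P a) (peval Q a)}"
proof -
  define D where "D = det (ctrb_poly_matrix P Q ** transpose (ctrb_poly_matrix P Q))"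
  have "poly D a\<^sub>0 \<noteq> 0"
    using assms by (simp add: D_def controllable_peval_iff)
  then have "finite {a. poly D a = 0}"
    by (intro poly_roots_finite) auto
  then show ?thesis
    by (simp add: D_def controllable_peval_iff)
qed

lemma finite_real_set_abs_bounded:
  fixes S :: "real set"
  assumes "finite S"
  shows "\<exists>b>0. \<forall>x\<in>S. \<bar>x\<bar> < b"
proof -
  obtain b where "b > 0" "\<forall>x\<in>S. \<bar>x\<bar> \<le> b"
    using bounded_pos[THEN iffD1, OF finite_imp_bounded[OF assms]] by auto
  then show ?thesis
    by (intro exI[of _ "b + 1"]) force
qed

theorem lemma3:
  fixes A :: "real^'n^'n" and B :: "real^'m^'n"
    and E :: "real poly^'n^'n" and F :: "real poly^'m^'n"
  assumes "controllable A B"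
    and "peval E 0 = 0" and "peval F 0 = 0"
  shows "\<exists>abar > 0. \<forall>a::real. \<bar>a\<bar> \<ge> abar \<longrightarrow>
           controllable (A + peval E a) (B + peval F a)"
proof -
  define P where "P = const_poly_matrix A + E"
  define Q where "Q = const_poly_matrix B + F"
  have peval_PQ: "peval P a = A + peval E a" "peval Q a = B + peval F a" for a
    by (simp_all add: P_def Q_def peval_add peval_const_poly_matrix)
  have "controllable (peval P 0) (peval Q 0)"
    using assms by (simp add: peval_PQ)
  then have "finite {a. \<not> controllable (peval P a) (peval Q a)}"
    by (rule finite_uncontrollable_parameters)
  then obtain abar where "abar > 0"
    and bound: "\<forall>a\<in>{a. \<not> controllable (peval P a) (peval Q a)}. \<bar>a\<bar> < abar"
    by (blast dest: finite_real_set_abs_bounded)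
  have "controllable (A + peval E a) (B + peval F a)" if "\<bar>a\<bar> \<ge> abar" for a
    using bound that by (force simp: peval_PQ)
  with \<open>abar > 0\<close> show ?thesis
    by blast
qed

end
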